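(* Let $\lambda=(\lambda_1,\ldots,\lambda_n)\in\mathbb{Z}^n$ be a partition. Then for all $p\in\mathbb{Z}$, with $p\lambda:=(p,\lambda_1,\ldots,\lambda_n)$, $$Q_{p\lambda}=q_pQ_\lambda+2\sum_{r\geq1}(-1)^rq_{p+r}Q_{\lambda/(r)}.$$
   Context: Let $x_1,x_2,\ldots$ be variables and define symmetric functions $q_n$ ($n\in\mathbb{Z}$) by $\prod_{i\ge1}\frac{1+zx_i}{1-zx_i}=\sum_{n\in\mathbb{Z}}q_nz^n$; so $q_0=1$ and $q_n=0$ for $n<0$. For $r,s\in\mathbb{Z}$ put $Q_{(r,s)}:=q_rq_s+2\sum_{i=1}^s(-1)^iq_{r+i}q_{s-i}$ (the sum is empty if $s<1$). A composition is a finite sequence of integers; a partition is a weakly decreasing composition with nonnegative parts. For a composition $\nu=(\nu_1,\ldots,\nu_N)$ let $M(\nu)$ be the $N\times N$ skew-symmetric matrix with $ij$-entry $Q_{(\nu_i,\nu_j)}$ if $i<j$, $0$ if $i=j$, and $-Q_{(\nu_j,\nu_i)}$ if $i>j$. For $\lambda\in\mathbb{Z}^n$ put $\lambda0:=(\lambda_1,\ldots,\lambda_n,0)$ and define $Q_\lambda:=\operatorname{Pf}M(\lambda)$ if $n$ is even and $Q_\lambda:=\operatorname{Pf}M(\lambda0)$ if $n$ is odd. Here $\operatorname{Pf}$ is the Pfaffian, normalized by $\operatorname{Pf}M=\sum_{j=2}^{2N}(-1)^jm_{1j}\operatorname{Pf}M_{1j}$, where $M_{1j}$ is $M$ with rows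 and columns $1,j$ deleted; the empty Pfaffian is $1$. For $\lambda\in\mathbb{Z}^n$, $\mu\in\mathbb{Z}^m$, let $N(\lambda,\mu)$ be the $n\times m$ matrix with $(i,j)$ entry $q_{\lambda_i-\mu_{m+1-j}}$, and $M(\lambda,\mu):=\begin{pmatrix}M(\lambda)&N(\lambda,\mu)\\-N(\lambda,\mu)^t&0\end{pmatrix}$. The skew function is $Q_{\lambda/\mu}:=\operatorname{Pf}M(\lambda,\mu)$ if $n+m$ is even and $\operatorname{Pf}M(\lambda0,\mu)$ if $n+m$ is odd. In $Q_{\lambda/(r)}$, $(r)$ is the one-part composition ($m=1$). *)

theory Defs
  imports
    "HOL-Library.Multiset"
    "HOL-Computational_Algebra.Formal_Power_Series"
    "Jordan_Normal_Form.Determinant"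
begin

section \<open>Formal power series in countably many variables\<close>

text \<open>
  The ambient ring is the ring of formal power series over the integers in the variables
  \<open>x\<^sub>0, x\<^sub>1, \<dots>\<close>, which contains the ring of symmetric functions.  A monomial is encoded as the
  finite multiset of the indices of its variables, so that the product of monomials is the
  union (sum) of multisets, and a series is its coefficient function.
\<close>

typedef mseries = "UNIV :: (nat multiset \<Rightarrow> int) set"
  morphisms mcoeff MSeries by simp

setup_lifting type_definition_mseries

lemma mseries_eqI: "(\<And>a. mcoeff f a = mcoeff g a) \<Longrightarrow> f = g"
  by (metis mcoeff_inverse ext)

lemma finite_submultisets: "finite {b. b \<subseteq># (a :: 'a multiset)}"
proof (induction a)
  case empty
  then show ?case by simp
next
  case (add x a)
  have "{b. b \<subseteq># add_mset x a} \<subseteq> {b. b \<subseteq># a} \<union> add_mset x ` {b. b \<subseteq># a}"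
  proof
    fix b assume "b \<in> {b. b \<subseteq># add_mset x a}"
    then have b: "b \<subseteq># add_mset x a" by simp
    show "b \<in> {b. b \<subseteq># a} \<union> add_mset x ` {b. b \<subseteq># a}"
    proof (cases "x \<in># b")
      case True
      then obtain c where c: "b = add_mset x c" by (metis mset_add)
      with b have "c \<subseteq># a" by simp
      with c show ?thesis by auto
    next
      case False
      with b have "b \<subseteq># a"
        by (metis diff_single_trivial subset_eq_diff_conv add_mset_add_single)
      then show ?thesis by simp
    qed
  qed
  with add show ?case by (meson finite_UnI finite_imageI finite_subset)
qed

definition splits :: "nat multiset \<Rightarrow> (nat multiset \<times> nat multiset) set" where
  "splits a = {(b, c). b + c = a}"

lemma finite_splits: "finite (splits a)"
proof (rule finite_subset)
  show "splits a \<subseteq> {b. b \<subseteq># a} \<times> {c. c \<subseteq># a}" by (auto simp: splits_def)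
qed (simp add: finite_submultisets)

instantiation mseries :: comm_ring_1
begin

lift_definition zero_mseries :: mseries is "\<lambda>_. 0" .
lift_definition one_mseries :: mseries is "\<lambda>a. if a = {#} then 1 else 0" .
lift_definition plus_mseries :: "mseries \<Rightarrow> mseries \<Rightarrow> mseries" is "\<lambda>f g a. f a + g a" .
lift_definition minus_mseries :: "mseries \<Rightarrow> mseries \<Rightarrow> mseries" is "\<lambda>f g a. f a - g a" .
lift_definition uminus_mseries :: "mseries \<Rightarrow> mseries" is "\<lambda>f a. - f a" .
lift_definition times_mseries :: "mseries \<Rightarrow> mseries \<Rightarrow> mseries" is
  "\<lambda>f g a. \<Sum>(b, c) \<in> splits a. f b * g c" .

instance
proof
  fix f g h :: mseries
  show "f * g * h = f * (g * h)"
  proof (rule mseries_eqI)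
    fix a
    let ?t = "\<lambda>(b, c, d). mcoeff f b * mcoeff g c * mcoeff h d"
    have "mcoeff (f * g * h) a =
        (\<Sum>p\<in>splits a. \<Sum>r\<in>splits (fst p). mcoeff f (fst r) * mcoeff g (snd r) * mcoeff h (snd p))"
      by (simp add: times_mseries.rep_eq case_prod_unfold sum_distrib_right)
    also have "\<dots> = (\<Sum>(p, r)\<in>(SIGMA p:splits a. splits (fst p)).
        mcoeff f (fst r) * mcoeff g (snd r) * mcoeff h (snd p))"
      by (rule sum.Sigma) (auto simp: finite_splits)
    also have "\<dots> = (\<Sum>x\<in>{(b, c, d). b + c + d = a}. ?t x)"
      by (rule sum.reindex_bij_witness[where
            i = "\<lambda>(b, c, d). ((b + c, d), (b, c))" and
            j = "\<lambda>((_, d), (b, c)). (b, c, d)"])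
         (auto simp: splits_def)
    also have "\<dots> = (\<Sum>(p, r)\<in>(SIGMA p:splits a. splits (snd p)).
        mcoeff f (fst p) * (mcoeff g (fst r) * mcoeff h (snd r)))"
      by (rule sum.reindex_bij_witness[where
            j = "\<lambda>(b, c, d). ((b, c + d), (c, d))" and
            i = "\<lambda>((b, _), (c, d)). (b, c, d)"])
         (auto simp: splits_def ac_simps)
    also have "\<dots> = (\<Sum>p\<in>splits a. \<Sum>r\<in>splits (snd p).
        mcoeff f (fst p) * (mcoeff g (fst r) * mcoeff h (snd r)))"
      by (rule sum.Sigma[symmetric]) (auto simp: finite_splits)
    also have "\<dots> = mcoeff (f * (g * h)) a"
      by (simp add: times_mseries.rep_eq case_prod_unfold sum_distrib_left)
    finally show "mcoeff (f * g * h) a = mcoeff (f * (g * h)) a" .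
  qed
  show "f * g = g * f"
  proof (rule mseries_eqI)
    fix a
    show "mcoeff (f * g) a = mcoeff (g * f) a"
      unfolding times_mseries.rep_eq
      by (rule sum.reindex_bij_witness[where i = prod.swap and j = prod.swap])
         (auto simp: splits_def ac_simps)
  qed
  show "1 * f = f"
  proof (rule mseries_eqI)
    fix a
    have "mcoeff (1 * f) a = (\<Sum>p\<in>splits a. if p = ({#}, a) then mcoeff f a else 0)"
      unfolding times_mseries.rep_eq
      by (rule sum.cong) (auto simp: splits_def one_mseries.rep_eq split: if_splits)
    also have "\<dots> = mcoeff f a"
      by (subst sum.delta) (auto simp: finite_splits, simp add: splits_def)
    finally show "mcoeff (1 * f) a = mcoeff f a" .
  qed
  show "(f + g) * h = f * h + g * h"
    by (rule mseries_eqI)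
       (simp add: times_mseries.rep_eq plus_mseries.rep_eq case_prod_unfold
          distrib_right sum.distrib)
  show "(0 :: mseries) \<noteq> 1"
    by (metis one_mseries.rep_eq zero_mseries.rep_eq zero_neq_one)
qed (transfer, simp add: fun_eq_iff algebra_simps)+

end

lift_definition mvar :: "nat \<Rightarrow> mseries" is "\<lambda>i a. if a = {#i#} then 1 else 0" .


section \<open>The symmetric functions \<open>q\<^sub>n\<close>\<close>

text \<open>
  The factor \<open>(1 + z x\<^sub>i) / (1 - z x\<^sub>i)\<close>, as a power series in \<open>z\<close>.  The ring of coefficients is not
  a field, so the reciprocal is taken with \<open>fps_right_inverse\<close>, which is justified by
  \<open>qfactor_mult\<close> below.
\<close>

definition qfactor :: "nat \<Rightarrow> mseries fps" where
  "qfactor i = (1 + fps_X * fps_const (mvar i)) *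
     fps_right_inverse (1 - fps_X * fps_const (mvar i)) 1"

lemma inverse_factor:
  "(1 - fps_X * fps_const (mvar i)) * fps_right_inverse (1 - fps_X * fps_const (mvar i)) 1 = 1"
  by (rule fps_right_inverse) simp

lemma qfactor_mult: "qfactor i * (1 - fps_X * fps_const (mvar i)) = 1 + fps_X * fps_const (mvar i)"
  by (metis (no_types, lifting) qfactor_def inverse_factor mult.assoc mult.commute mult_1_right)

text \<open>
  The infinite product is the coefficientwise limit of the finite products; each coefficient is
  eventually constant (\<open>mcoeff_q_eventually\<close> below).
\<close>

definition q :: "int \<Rightarrow> mseries" where
  "q n = (if n < 0 then 0 else
     MSeries (\<lambda>a. THE c. \<forall>\<^sub>F N in sequentially.
       mcoeff (fps_nth (\<Prod>i<N. qfactor i) (nat n)) a = c))"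

lemma mcoeff_mult_mvar:
  assumes "i \<notin># a"
  shows "mcoeff (f * mvar i) a = 0"
  using assms unfolding times_mseries.rep_eq
  by (intro sum.neutral) (auto simp: splits_def mvar.rep_eq)

lemma qfactor_decomp: "\<exists>h. qfactor i = 1 + h * fps_const (mvar i)"
proof -
  let ?x = "fps_const (mvar i)"
  let ?r = "fps_right_inverse (1 - fps_X * ?x) 1"
  have "?r = 1 + fps_X * ?x * ?r"
    using inverse_factor[of i] by (simp add: algebra_simps)
  then have "qfactor i = 1 + (fps_X * ?r + fps_X * ?r) * ?x"
    unfolding qfactor_def by (simp add: algebra_simps)
  then show ?thesis by blast
qed

lemma mcoeff_q_stable:
  "\<exists>N0. \<forall>N\<ge>N0. mcoeff (fps_nth (\<Prod>i<N. qfactor i) n) a = mcoeff (fps_nth (\<Prod>i<N0. qfactor i) n) a"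
proof -
  obtain N0 where N0: "\<And>i. i \<in># a \<Longrightarrow> i < N0"
    by (metis finite_nat_set_iff_bounded finite_set_mset)
  have "mcoeff (fps_nth (\<Prod>i<N. qfactor i) n) a = mcoeff (fps_nth (\<Prod>i<N0. qfactor i) n) a"
    if "N \<ge> N0" for N
    using that
  proof (induction N rule: dec_induct)
    case base
    then show ?case by simp
  next
    case (step N)
    obtain h where h: "qfactor N = 1 + h * fps_const (mvar N)" using qfactor_decomp by blast
    have "N \<notin># a" using N0 step.hyps by (meson not_le)
    have "(\<Prod>i<Suc N. qfactor i) =
        (\<Prod>i<N. qfactor i) + ((\<Prod>i<N. qfactor i) * h) * fps_const (mvar N)"
      by (simp add: h algebra_simps)
    then show ?case
      using step.IH \<open>N \<notin># a\<close> by (simp add: plus_mseries.rep_eq mcoeff_mult_mvar)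
  qed
  then show ?thesis by blast
qed

lemma mcoeff_q_eventually:
  "\<forall>\<^sub>F N in sequentially. mcoeff (fps_nth (\<Prod>i<N. qfactor i) n) a = mcoeff (q (int n)) a"
proof -
  let ?s = "\<lambda>N. mcoeff (fps_nth (\<Prod>i<N. qfactor i) n) a"
  obtain N0 where N0: "\<forall>N\<ge>N0. ?s N = ?s N0" using mcoeff_q_stable by blast
  then have ev: "\<forall>\<^sub>F N in sequentially. ?s N = ?s N0"
    unfolding eventually_sequentially by blast
  have "(THE c. \<forall>\<^sub>F N in sequentially. ?s N = c) = ?s N0"
  proof (rule the_equality)
    fix c assume "\<forall>\<^sub>F N in sequentially. ?s N = c"
    with ev have "\<forall>\<^sub>F N in sequentially. c = ?s N0" by eventually_elim simp
    then show "c = ?s N0" by simp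
  qed (fact ev)
  then show ?thesis using ev by (simp add: q_def MSeries_inverse)
qed


section \<open>Pfaffians\<close>

text \<open>
  Expansion along the first row.  Indices start at 0, which is why the sign is \<open>(- 1) ^ (j + 1)\<close>.
  The inner \<^const>\<open>mat_delete\<close> removes row and column \<open>j\<close>, the outer one row and column 0.
  Only square matrices of even size are relevant.
\<close>

function pfaffian :: "'a :: comm_ring_1 mat \<Rightarrow> 'a" where
  "pfaffian A = (if dim_row A = 0 then 1 else
     \<Sum>j = 1..<dim_row A. (- 1) ^ (j + 1) * A $$ (0, j) * pfaffian (mat_delete (mat_delete A j j) 0 0))"
  by auto
termination by (relation "measure dim_row") auto

declare pfaffian.simps [simp del]


section \<open>The functions \<open>Q\<^sub>\<lambda>\<close> and \<open>Q\<^bsub>\<lambda>/\<mu>\<^esub>\<close>\<close>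

definition is_partition :: "int list \<Rightarrow> bool" where
  "is_partition l \<longleftrightarrow> sorted_wrt (\<ge>) l \<and> (\<forall>x\<in>set l. 0 \<le> x)"

definition Q2 :: "int \<Rightarrow> int \<Rightarrow> mseries" where
  "Q2 r s = q r * q s + 2 * (\<Sum>i = 1..s. (- 1) ^ nat i * q (r + i) * q (s - i))"

definition M_mat :: "int list \<Rightarrow> mseries mat" where
  "M_mat v = mat (length v) (length v) (\<lambda>(i, j).
     if i < j then Q2 (v ! i) (v ! j) else if i = j then 0 else - Q2 (v ! j) (v ! i))"

definition Q :: "int list \<Rightarrow> mseries" where
  "Q l = (if even (length l) then pfaffian (M_mat l) else pfaffian (M_mat (l @ [0])))"

text \<open>
  The columns use the parts of \<open>\<mu>\<close> in reverse order: with indices from 0, column \<open>j\<close> belongs to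
  the part with index \<open>m - 1 - j\<close>.
\<close>

definition N_mat :: "int list \<Rightarrow> int list \<Rightarrow> mseries mat" where
  "N_mat l m = mat (length l) (length m) (\<lambda>(i, j). q (l ! i - m ! (length m - 1 - j)))"

definition M_skew_mat :: "int list \<Rightarrow> int list \<Rightarrow> mseries mat" where
  "M_skew_mat l m = four_block_mat (M_mat l) (N_mat l m)
     (- transpose_mat (N_mat l m)) (0\<^sub>m (length m) (length m))"

definition Q_skew :: "int list \<Rightarrow> int list \<Rightarrow> mseries" where
  "Q_skew l m = (if even (length l + length m) then pfaffian (M_skew_mat l m)
     else pfaffian (M_skew_mat (l @ [0]) m))"

end

theory Submission
  imports Defs
begin

text \<open>
  Expand the Pfaffian \<open>Q\<^bsub>p\<lambda>\<^esub>\<close> along its first row and insert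
  \<open>Q\<^bsub>(p,s)\<^esub> = q\<^sub>p q\<^sub>s + 2 \<Sum>\<^bsub>r\<ge>1\<^esub> (-1)\<^sup>r q\<^bsub>p+r\<^esub> q\<^bsub>s-r\<^esub>\<close>.  The coefficient of \<open>q\<^bsub>p+r\<^esub>\<close> is an alternating sum
  that is the expansion of \<open>Q\<^bsub>\<lambda>/(r)\<^esub>\<close> along its last column.  For \<open>r = 0\<close> it is the expansion of
  \<open>Q\<^sub>\<lambda>\<close> along its last column if \<open>\<lambda>\<close> has odd length; if the length is even, it is \<open>Q\<^sub>\<lambda>\<close> plus the
  Pfaffian of a matrix with two equal columns, which vanishes.
\<close>

section \<open>Alternating sums over the elements of a list\<close>

text \<open>
  The sum of \<open>(-1)\<^sup>j G x\<^sub>j xs\<^sub>j\<close>, where \<open>xs\<^sub>j\<close> is the list without its \<open>j\<close>-th element \<open>x\<^sub>j\<close>.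
  The recursive form makes the sign rules for iterated sums provable by plain list induction.
\<close>

fun altsum :: "('a \<Rightarrow> 'a list \<Rightarrow> 'b :: comm_ring_1) \<Rightarrow> 'a list \<Rightarrow> 'b" where
  "altsum G [] = 0"
| "altsum G (x # xs) = G x xs - altsum (\<lambda>y ys. G y (x # ys)) xs"

text \<open>The length equation tells the termination proof of \<open>pf\<close> that its recursive
  calls get shorter lists.\<close>

lemma altsum_cong [fundef_cong]:
  assumes "xs = xs'"
    and "\<And>y ys. y \<in> set xs' \<Longrightarrow> length xs' = Suc (length ys) \<Longrightarrow> G y ys = H y ys"
  shows "altsum G xs = altsum H xs'"
  unfolding assms(1) using assms(2)
proof (induction xs' arbitrary: G H)
  case (Cons x xs)
  have "altsum (\<lambda>y ys. G y (x # ys)) xs = altsum (\<lambda>y ys. H y (x # ys)) xs"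
    by (rule Cons.IH) (simp add: Cons.prems)
  then show ?case by (simp add: Cons.prems)
qed simp

lemma altsum_zero [simp]: "altsum (\<lambda>y ys. 0) xs = 0"
  by (induction xs) auto

lemma altsum_add: "altsum (\<lambda>y ys. G y ys + H y ys) xs = altsum G xs + altsum H xs"
  by (induction xs arbitrary: G H) auto

lemma altsum_diff: "altsum (\<lambda>y ys. G y ys - H y ys) xs = altsum G xs - altsum H xs"
  by (induction xs arbitrary: G H) auto

lemma altsum_mult_left: "altsum (\<lambda>y ys. c * G y ys) xs = c * altsum G xs"
  by (induction xs arbitrary: G) (auto simp: algebra_simps)

lemma altsum_sum: "altsum (\<lambda>y ys. \<Sum>i\<in>I. G i y ys) xs = (\<Sum>i\<in>I. altsum (G i) xs)"
  by (induction I rule: infinite_finite_induct) (auto simp: altsum_add)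

lemma altsum_map: "altsum G (map g xs) = altsum (\<lambda>y ys. G (g y) (map g ys)) xs"
  by (induction xs arbitrary: G) auto

lemma altsum_snoc:
  "altsum G (xs @ [z]) = altsum (\<lambda>y ys. G y (ys @ [z])) xs + (- 1) ^ length xs * G z xs"
  by (induction xs arbitrary: G) auto

lemma altsum_conv_sum:
  "altsum G xs = (\<Sum>j<length xs. (- 1) ^ j * G (xs ! j) (take j xs @ drop (Suc j) xs))"
  by (induction xs arbitrary: G)
     (auto simp: sum.lessThan_Suc_shift sum_negf simp del: sum.lessThan_Suc)

text \<open>Removing two elements in either order leaves the same list but with opposite signs, so
  the terms cancel in pairs.\<close>

lemma altsum_altsum_symmetric:
  assumes "\<And>y z zs. G y z zs = G z y zs"
  shows "altsum (\<lambda>y. altsum (G y)) xs = 0"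
  using assms
proof (induction xs arbitrary: G)
  case (Cons x xs)
  have "altsum (\<lambda>y. altsum (\<lambda>z zs. G y z (x # zs))) xs = 0"
    by (rule Cons.IH) (rule Cons.prems)
  moreover have "altsum (\<lambda>y ys. G y x ys) xs = altsum (G x) xs"
    by (rule altsum_cong) (simp_all add: Cons.prems)
  ultimately show ?case by (simp add: altsum_diff)
qed simp

lemma altsum_altsum_swap:
  "altsum (\<lambda>y. altsum (G y)) xs = - altsum (\<lambda>y. altsum (\<lambda>z. G z y)) xs"
proof -
  have "altsum (\<lambda>y. altsum (\<lambda>z zs. G y z zs + G z y zs)) xs = 0"
    by (rule altsum_altsum_symmetric) (rule add.commute)
  then have "altsum (\<lambda>y. altsum (G y)) xs + altsum (\<lambda>y. altsum (\<lambda>z. G z y)) xs = 0"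
    by (simp only: flip: altsum_add)
  then show ?thesis by (simp only: eq_neg_iff_add_eq_0)
qed


section \<open>Pfaffians indexed by lists\<close>

text \<open>The Pfaffian of the skew-symmetric matrix whose entries above the diagonal are given by
  \<open>f\<close>, expanded along the first row.\<close>

function pf :: "('a \<Rightarrow> 'a \<Rightarrow> 'b :: comm_ring_1) \<Rightarrow> 'a list \<Rightarrow> 'b" where
  "pf f [] = 1"
| "pf f (x # xs) = altsum (\<lambda>y ys. f x y * pf f ys) xs"
  by pat_completeness auto
termination by (relation "measure (length \<circ> snd)") auto

lemma pf_map: "pf f (map g xs) = pf (\<lambda>x y. f (g x) (g y)) xs"
proof (induction xs rule: length_induct)
  case (1 xs)
  show ?case
  proof (cases xs)
    case (Cons x ws)
    have "altsum (\<lambda>y ys. f (g x) (g y) * pf f (map g ys)) ws =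
        altsum (\<lambda>y ys. f (g x) (g y) * pf (\<lambda>x y. f (g x) (g y)) ys) ws"
      by (rule altsum_cong) (use 1 Cons in auto)
    then show ?thesis by (simp add: Cons altsum_map)
  qed simp
qed

text \<open>Expansion along the last column: expand along the first row, then each minor along its
  last column by induction, and swap the two sums.\<close>

lemma pf_snoc:
  fixes xs :: "'a list"
  assumes "odd (length xs)"
  shows "pf f (xs @ [z]) = altsum (\<lambda>y ys. f y z * pf f ys) xs"
  using assms
proof (induction xs rule: length_induct)
  case (1 xs)
  then obtain x ws where xs: "xs = x # ws" and ws: "even (length ws)"
    by (cases xs) auto
  have "altsum (\<lambda>y ys. f x y * pf f (ys @ [z])) ws =
      altsum (\<lambda>y. altsum (\<lambda>u us. f x y * (f u z * pf f us))) ws"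
  proof (rule altsum_cong)
    fix y and ys :: "'a list"
    assume "length ws = Suc (length ys)"
    with 1 xs ws have "pf f (ys @ [z]) = altsum (\<lambda>u us. f u z * pf f us) ys" by auto
    then show "f x y * pf f (ys @ [z]) = altsum (\<lambda>u us. f x y * (f u z * pf f us)) ys"
      by (simp add: altsum_mult_left)
  qed simp
  also have "\<dots> = - altsum (\<lambda>y. altsum (\<lambda>u us. f x u * (f y z * pf f us))) ws"
    by (rule altsum_altsum_swap)
  also have "\<dots> = - altsum (\<lambda>y ys. f y z * pf f (x # ys)) ws"
    by (simp add: altsum_mult_left[symmetric] mult.left_commute)
  \<comment> \<open>Pairing \<open>x\<close> with \<open>z\<close> gives
    \<open>f x z * pf f ws\<close> on both sides; on the left its sign is plus because
    \<open>ws\<close> has even length.\<close>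
  finally show ?case by (simp add: xs ws altsum_snoc)
qed

lemma pfaffian_eq_pf:
  assumes "A \<in> carrier_mat (length xs) (length xs)"
    and "\<And>i j. i < j \<Longrightarrow> j < length xs \<Longrightarrow> A $$ (i, j) = f (xs ! i) (xs ! j)"
  shows "pfaffian A = pf f xs"
  using assms
proof (induction xs arbitrary: A rule: length_induct)
  case (1 xs)
  show ?case
  proof (cases xs)
    case Nil
    with 1 show ?thesis by (simp add: pfaffian.simps)
  next
    case (Cons x ws)
    have A: "dim_row A = Suc (length ws)" "dim_col A = Suc (length ws)"
      using 1(2) Cons by auto
    have entry: "A $$ (i, j) = f ((x # ws) ! i) ((x # ws) ! j)" if "i < j" "j < Suc (length ws)" for i j
      using 1(3)[of i j] that Cons by auto
    let ?del = "\<lambda>j. mat_delete (mat_delete A (Suc j) (Suc j)) 0 0"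
    have minor: "pfaffian (?del j) = pf f (take j ws @ drop (Suc j) ws)" if "j < length ws" for j
    proof (rule 1(1)[rule_format])
      show "length (take j ws @ drop (Suc j) ws) < length xs" using that Cons by simp
      show "?del j \<in> carrier_mat (length (take j ws @ drop (Suc j) ws))
          (length (take j ws @ drop (Suc j) ws))"
        using that A by (auto simp: mat_delete_def)
      fix k l assume "k < l" "l < length (take j ws @ drop (Suc j) ws)"
      with that show "?del j $$ (k, l) =
          f ((take j ws @ drop (Suc j) ws) ! k) ((take j ws @ drop (Suc j) ws) ! l)"
        using A by (auto simp: mat_delete_def entry nth_append min_def)
    qed
    have "pfaffian A = (\<Sum>j = 1..<Suc (length ws). (- 1) ^ (j + 1) * A $$ (0, j) *
        pfaffian (mat_delete (mat_delete A j j) 0 0))"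
      by (subst pfaffian.simps) (simp add: A)
    also have "\<dots> = (\<Sum>j<length ws. (- 1) ^ j * (A $$ (0, Suc j) * pfaffian (?del j)))"
      by (simp add: sum.atLeast_Suc_lessThan_Suc_shift atLeast0LessThan mult.assoc
          del: sum.op_ivl_Suc)
    also have "\<dots> = (\<Sum>j<length ws. (- 1) ^ j *
        (f x (ws ! j) * pf f (take j ws @ drop (Suc j) ws)))"
      by (rule sum.cong) (simp_all add: minor entry)
    finally show ?thesis by (simp add: Cons altsum_conv_sum)
  qed
qed


section \<open>Expansions of \<open>Q\<close>-functions\<close>

lemma q_0: "q 0 = 1"
proof (rule mseries_eqI)
  fix a
  have nth_0: "fps_nth (\<Prod>i<N. qfactor i) 0 = 1" for N
    by (induction N) (simp_all add: qfactor_def)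
  show "mcoeff (q 0) a = mcoeff 1 a"
    using mcoeff_q_eventually[of 0 a] by (simp add: nth_0)
qed

lemma q_neg: "n < 0 \<Longrightarrow> q n = 0"
  by (simp add: q_def)

text \<open>Hence the column of an appended part 0 equals the border column for the skewing part
  0.\<close>

lemma Q2_0_right: "Q2 y 0 = q y"
  by (simp add: Q2_def q_0)

text \<open>A summation range that does not depend on \<open>s\<close> lets the sum over
  \<open>r\<close> be moved out of the expansion.\<close>

lemma Q2_conv_nat_sum:
  assumes "s \<le> int R"
  shows "Q2 p s = q p * q s + 2 * (\<Sum>r = 1..R. (- 1) ^ r * q (p + int r) * q (s - int r))"
proof -
  have "(\<Sum>i = 1..s. (- 1) ^ nat i * q (p + i) * q (s - i)) =
      (\<Sum>i = 1..int R. (- 1) ^ nat i * q (p + i) * q (s - i))"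
    using assms by (intro sum.mono_neutral_left) (auto simp: q_neg)
  also have "\<dots> = (\<Sum>r = 1..R. (- 1) ^ r * q (p + int r) * q (s - int r))"
    by (rule sum.reindex_bij_witness[where i = int and j = nat]) auto
  finally show ?thesis by (simp add: Q2_def)
qed

text \<open>For \<open>xs\<close> of odd length this is the last-column expansion of the Pfaffian
  bordered by the column \<open>q (y - r)\<close>.\<close>

definition skew_expansion :: "int list \<Rightarrow> int \<Rightarrow> mseries" where
  "skew_expansion xs r = altsum (\<lambda>y ys. q (y - r) * pf Q2 ys) xs"

lemma skew_expansion_eq_0:
  assumes "\<And>y. y \<in> set xs \<Longrightarrow> y < r"
  shows "skew_expansion xs r = 0"
proof -
  have "skew_expansion xs r = altsum (\<lambda>y ys. 0) xs"
    unfolding skew_expansion_def by (rule altsum_cong) (use assms in \<open>auto simp: q_neg\<close>)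
  then show ?thesis by simp
qed

lemma pf_Q2_Cons:
  assumes "\<And>y. y \<in> set xs \<Longrightarrow> y \<le> int R"
  shows "pf Q2 (p # xs) = q p * skew_expansion xs 0 +
    2 * (\<Sum>r = 1..R. (- 1) ^ r * q (p + int r) * skew_expansion xs (int r))"
proof -
  have "pf Q2 (p # xs) = altsum (\<lambda>y ys. q p * (q (y - 0) * pf Q2 ys) +
      2 * (\<Sum>r = 1..R. (- 1) ^ r * q (p + int r) * (q (y - int r) * pf Q2 ys))) xs"
    unfolding pf.simps
    by (rule altsum_cong)
       (simp_all add: Q2_conv_nat_sum[OF assms] distrib_right sum_distrib_right mult.assoc)
  then show ?thesis
    by (simp only: skew_expansion_def altsum_add altsum_mult_left altsum_sum)
qed

lemma pf_Q2_snoc_0: "odd (length xs) \<Longrightarrow> pf Q2 (xs @ [0]) = skew_expansion xs 0"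
  by (simp add: pf_snoc Q2_0_right skew_expansion_def)

text \<open>The border column and the column of the part 0 agree, so only the term pairing these
  two, \<open>q 0 * pf Q2 xs\<close>, survives.\<close>

lemma skew_expansion_snoc_0:
  assumes "even (length xs)"
  shows "skew_expansion (xs @ [0]) 0 = pf Q2 xs"
proof -
  have "altsum (\<lambda>y ys. q y * pf Q2 (ys @ [0])) xs =
      altsum (\<lambda>y. altsum (\<lambda>z zs. q y * (q z * pf Q2 zs))) xs"
    using assms
    by (intro altsum_cong) (auto simp: pf_Q2_snoc_0 skew_expansion_def altsum_mult_left)
  also have "\<dots> = 0"
    by (rule altsum_altsum_symmetric) (rule mult.left_commute)
  finally show ?thesis
    using assms by (simp add: skew_expansion_def altsum_snoc q_0)
qed

lemma pfaffian_M_mat: "pfaffian (M_mat l) = pf Q2 l"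
  by (rule pfaffian_eq_pf) (auto simp: M_mat_def)

text \<open>
  The last row and column of the bordered matrix belong to the index \<^const>\<open>None\<close>.
\<close>

lemma pfaffian_M_skew_mat:
  assumes "odd (length l)"
  shows "pfaffian (M_skew_mat l [r]) = skew_expansion l r"
proof -
  define f where "f = (\<lambda>a b. case (a, b) of
      (Some x, Some y) \<Rightarrow> Q2 x y | (Some x, None) \<Rightarrow> q (x - r) | _ \<Rightarrow> 0)"
  have "pfaffian (M_skew_mat l [r]) = pf f (map Some l @ [None])"
    by (rule pfaffian_eq_pf)
       (auto simp: M_skew_mat_def M_mat_def N_mat_def f_def nth_append less_Suc_eq)
  also have "\<dots> = skew_expansion l r"
    using assms by (simp add: pf_snoc altsum_map pf_map f_def skew_expansion_def)
  finally show ?thesis .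
qed

lemma Q_skew_single:
  "Q_skew l [r] = skew_expansion (if odd (length l) then l else l @ [0]) r"
  by (simp add: Q_skew_def pfaffian_M_skew_mat)

lemma Q_conv_skew_expansion:
  "Q l = skew_expansion (if odd (length l) then l else l @ [0]) 0"
  by (simp add: Q_def pfaffian_M_mat pf_Q2_snoc_0 skew_expansion_snoc_0)

lemma Q_Cons_conv_pf:
  "Q (p # l) = pf Q2 (p # (if odd (length l) then l else l @ [0]))"
  by (simp add: Q_def pfaffian_M_mat del: pf.simps)

theorem theorem4p7:
  fixes lambda :: "int list" and p :: int
  assumes "is_partition lambda"
  shows "finite {r :: nat. r \<ge> 1 \<and> Q_skew lambda [int r] \<noteq> 0} \<and>
    Q (p # lambda) = q p * Q lambda +
      2 * (\<Sum>r | r \<ge> 1 \<and> Q_skew lambda [int r] \<noteq> 0.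
             (- 1) ^ r * q (p + int r) * Q_skew lambda [int r])"
proof -
  define xs where "xs = (if odd (length lambda) then lambda else lambda @ [0])"
  \<comment> \<open>For \<open>r > R\<close> every \<open>q (y - r)\<close> with \<open>y\<close> in
    \<open>xs\<close> vanishes, which truncates the sum over \<open>r\<close>.\<close>
  define R where "R = nat (Max (insert 0 (set xs)))"
  have "y \<le> Max (insert 0 (set xs))" if "y \<in> set xs" for y
    using that by simp
  then have R: "y \<le> int R" if "y \<in> set xs" for y
    using that unfolding R_def by fastforce
  have skew: "Q_skew lambda [int r] = skew_expansion xs (int r)" for r
    by (simp add: Q_skew_single xs_def)
  have "Q_skew lambda [int r] = 0" if "r > R" for r
    unfolding skew by (rule skew_expansion_eq_0) (use R that in fastforce)
  then have sub: "{r. r \<ge> 1 \<and> Q_skew lambda [int r] \<noteq> 0} \<subseteq> {1..R}"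
    by (auto simp: not_less[symmetric])
  have "Q (p # lambda) = q p * Q lambda +
      2 * (\<Sum>r = 1..R. (- 1) ^ r * q (p + int r) * Q_skew lambda [int r])"
    unfolding Q_Cons_conv_pf Q_conv_skew_expansion[of lambda] skew xs_def[symmetric]
    by (rule pf_Q2_Cons) (rule R)
  also have "(\<Sum>r = 1..R. (- 1) ^ r * q (p + int r) * Q_skew lambda [int r]) =
      (\<Sum>r | r \<ge> 1 \<and> Q_skew lambda [int r] \<noteq> 0.
        (- 1) ^ r * q (p + int r) * Q_skew lambda [int r])"
    using sub by (intro sum.mono_neutral_right) auto
  finally show ?thesis
    using sub finite_subset by blast
qed

end
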